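(* Let $X=(X_1,\ldots,X_N)$ be a family of (not necessarily independent) random variables with $X_k$ taking values in a set $\Lambda_k$, where $\max_{\eta\in\Lambda_k}\mathbb{P}(X_k=\eta\mid X_1,\ldots,X_{k-1})\ge1-p_k$ holds for numbers $p_k\in[0,1)$. Let $\Gamma\subseteq\prod_{j\in[N]}\Lambda_j$ be an event, and let $f:\prod_{j\in[N]}\Lambda_j\to\mathbb{R}$ be a function satisfying the following general Lipschitz condition: there are numbers $(c_k)_{k\in[N]}$ and $(d_k)_{k\in[N]}$ with $c_k\le d_k$ such that the following holds for every $k\in[N]$ and any two possible sequences of outcomes $a_1,\ldots,a_{k-1},a$ and $a_1,\ldots,a_{k-1},b$ of $X_1,\ldots,X_k$. Defining, for $z\in\{a,b\}$, $$\Sigma_z=\Bigl\{x=(a_1,\ldots,a_{k-1},z,x_{k+1},\ldots,x_N)\in\prod_{j\in[N]}\Lambda_j:\ \mathbb{P}(X=x)>0\Bigr\},$$ there is an injection $\rho_k=\rho_k(\Sigma_a,\Sigma_b):\Sigma_a\to\Sigma_b$ such that for all $x\in\Sigma_a$ we have $|f(x)-f(\rho_k(x))|\le c_k$ if $x\in\Gamma$, $|f(x)-f(\rho_k(x))|\le d_k$ otherwise, and $$\mathbb{P}(X=x\mid X\in\Sigma_a)\le\mathbb{P}(X=\rho_k(x)\mid X\in\Sigma_b).$$ Then for any numbers $(\gamma_k)_{k\in[N]}$ with $\gamma_k\in(0,1]$ there is an event $\mathcal{B}=\mathcal{B}(\Gamma,(\gamma_k)_{k\in[N]})$ satisfying $$\mathbb{P}(\mathcal{B})\le\sum_{k\in[N]}\gamma_k^{-1}\cdot\mathbb{P}(X\notin\Gamma)\quad\text{and}\quad\neg\mathcal{B}\subseteq\Gamma,$$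 such that for $\mu=\mathbb{E}f(X)$ and any $t\ge0$ we have $$\mathbb{P}(f(X)\ge\mu+t\text{ and }\neg\mathcal{B})\le\exp\left(-\frac{t^2}{2\sum_{k\in[N]}p_k\left(c_k+e_k\cdot(1-p_k)^{-1}\right)^2+2Ct/3}\right),$$ where $e_k=\gamma_k(d_k-c_k)$ and $C=\max_{k\in[N]}(c_k+e_k)$.
   Context: $[N]=\{1,\ldots,N\}$. The random variables are discrete (their joint law is determined by the point probabilities $\mathbb{P}(X=x)$). A sequence of outcomes of $X_1,\ldots,X_k$ is possible if it occurs with positive probability. Events $\mathcal{B},\Gamma$ are identified with subsets of $\prod_{j\in[N]}\Lambda_j$; $\mathbb{P}(\mathcal{B})=\mathbb{P}(X\in\mathcal{B})$ and $\neg\mathcal{B}$ is the complement. The notation $\mathcal{B}=\mathcal{B}(\Gamma,(\gamma_k)_{k\in[N]})$ means that $\mathcal{B}$ depends only on $\Gamma$ and $(\gamma_k)$ (and the law of $X$), not on $f$ or $t$. *)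

theory Defs
  imports "HOL-Probability.Probability"
begin

text \<open>
  The joint law of the discrete family \<open>X = (X\<^sub>1, \<dots>, X\<^sub>N)\<close> is a probability mass function \<open>P\<close> on
  tuples \<open>x \<in> PiE {1..N} \<Lambda>\<close>; the random variable \<open>X\<^sub>k\<close> is the coordinate \<open>x k\<close>, and an event is a
  set of tuples. A sequence of outcomes \<open>a\<^sub>1, \<dots>, a\<^sub>k\<close> is represented by a total function \<open>a\<close> of
  which only the values on \<open>{1..k}\<close> are used; \<open>a(k := z)\<close> is the sequence \<open>a\<^sub>1, \<dots>, a\<^bsub>k-1\<^esub>, z\<close>.
\<close>

definition possible :: "(nat \<Rightarrow> 'a) pmf \<Rightarrow> nat \<Rightarrow> (nat \<Rightarrow> 'a) \<Rightarrow> bool" where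
  "possible P k a \<longleftrightarrow> \<P>(x in P. \<forall>j\<in>{1..k}. x j = a j) > 0"

text \<open>
  Conditioning on \<open>X\<^sub>1, \<dots>, X\<^bsub>k-1\<^esub>\<close> means conditioning on each of their possible sequences of outcomes.
  That the maximum over \<open>\<Lambda> k\<close> is at least \<open>1 - p k\<close> is expressed by an element with this property.
\<close>

definition concentrated ::
  "(nat \<Rightarrow> 'a) pmf \<Rightarrow> nat \<Rightarrow> (nat \<Rightarrow> 'a set) \<Rightarrow> (nat \<Rightarrow> real) \<Rightarrow> bool" where
  "concentrated P N \<Lambda> p \<longleftrightarrow>
     (\<forall>k\<in>{1..N}. \<forall>a. possible P (k - 1) a \<longrightarrow>
        (\<exists>\<eta>\<in>\<Lambda> k. \<P>(x in P. x k = \<eta> \<bar> \<forall>j\<in>{1..k-1}. x j = a j) \<ge> 1 - p k))"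

definition extensions ::
  "(nat \<Rightarrow> 'a) pmf \<Rightarrow> nat \<Rightarrow> (nat \<Rightarrow> 'a set) \<Rightarrow> nat \<Rightarrow> (nat \<Rightarrow> 'a) \<Rightarrow> 'a \<Rightarrow> (nat \<Rightarrow> 'a) set" where
  "extensions P N \<Lambda> k a z =
     {x \<in> PiE {1..N} \<Lambda>. (\<forall>j\<in>{1..k-1}. x j = a j) \<and> x k = z \<and> pmf P x > 0}"

definition general_Lipschitz ::
  "(nat \<Rightarrow> 'a) pmf \<Rightarrow> nat \<Rightarrow> (nat \<Rightarrow> 'a set) \<Rightarrow> (nat \<Rightarrow> 'a) set \<Rightarrow>
   ((nat \<Rightarrow> 'a) \<Rightarrow> real) \<Rightarrow> (nat \<Rightarrow> real) \<Rightarrow> (nat \<Rightarrow> real) \<Rightarrow> bool" where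
  "general_Lipschitz P N \<Lambda> \<Gamma> f c d \<longleftrightarrow>
     (\<forall>k\<in>{1..N}. \<forall>a u v. possible P k (a(k := u)) \<and> possible P k (a(k := v)) \<longrightarrow>
        (let \<Sigma>u = extensions P N \<Lambda> k a u; \<Sigma>v = extensions P N \<Lambda> k a v in
          \<exists>\<rho>. inj_on \<rho> \<Sigma>u \<and> \<rho> ` \<Sigma>u \<subseteq> \<Sigma>v \<and>
            (\<forall>x\<in>\<Sigma>u.
               \<bar>f x - f (\<rho> x)\<bar> \<le> (if x \<in> \<Gamma> then c k else d k) \<and>
               \<P>(y in P. y = x \<bar> y \<in> \<Sigma>u) \<le> \<P>(y in P. y = \<rho> x \<bar> y \<in> \<Sigma>v))))"

end

theory Submission
  imports Defs
begin

text \<open>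
  Write \<open>Y\<^sub>k\<close> for the conditional expectation of \<open>f(X)\<close> given \<open>X\<^sub>1, \<dots>, X\<^sub>k\<close>. Between conditional laws
  of \<open>X\<close> the injections \<open>\<rho>\<^sub>k\<close> do not decrease point probabilities, hence they preserve measure, and so
  replacing the outcome \<open>a\<close> of \<open>X\<^sub>k\<close> by another one changes \<open>Y\<^sub>k\<close> by at most \<open>c\<^sub>k\<close> plus
  \<open>d\<^sub>k - c\<^sub>k\<close> times the conditional probability of the complement of \<open>\<Gamma>\<close> given \<open>X\<^sub>k = a\<close>. As long as the
  conditional probability of that complement given \<open>X\<^sub>1, \<dots>, X\<^bsub>k-1\<^esub>\<close> is at most \<open>\<gamma>\<^sub>k\<close>, averaging over \<open>a\<close>
  bounds the increment \<open>Y\<^sub>k - Y\<^bsub>k-1\<^esub>\<close> by \<open>c\<^sub>k + e\<^sub>k\<close>, and its conditional variance is at most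
  \<open>p\<^sub>k (c\<^sub>k + e\<^sub>k / (1 - p\<^sub>k))\<^sup>2\<close>. The Bernstein argument applies to the martingale with all other increments
  removed. By Markov's inequality an increment is removed with probability at most \<open>\<gamma>\<^sub>k\<^sup>-\<^sup>1\<close> times the
  probability of the complement of \<open>\<Gamma>\<close>; the first of these events is trivial, which leaves room
  for that complement itself.
\<close>

section \<open>Bernstein's estimate of the exponential function\<close>

text \<open>For \<open>y > 0\<close> the inequality \<open>2 * 3 ^ n \<le> fact (n + 2)\<close>
  dominates the series beyond the linear term by a geometric one with ratio \<open>y / 3\<close>.
  For \<open>y \<le> 0\<close> the cubic Taylor remainder is at most zero, so the quadratic Taylor
  polynomial is already an upper bound.\<close>

lemma exp_le_quadratic:
  fixes y b :: real
  assumes "y \<le> b" "0 \<le> b" "b < 3"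
  shows "exp y \<le> 1 + y + y\<^sup>2 / (2 * (1 - b / 3))"
proof (cases "y \<le> 0")
  case True
  obtain t where t: "exp y = (\<Sum>m<3. y ^ m / fact m) + exp t / fact 3 * y ^ 3"
    using Maclaurin_exp_le[of y 3] by blast
  have "exp t / fact 3 * y ^ 3 \<le> 0"
    using True by (intro mult_nonneg_nonpos) (auto simp: power_le_zero_eq)
  then have "exp y \<le> 1 + y + y\<^sup>2 / 2"
    using t by (simp add: eval_nat_numeral)
  also have "y\<^sup>2 / 2 \<le> y\<^sup>2 / (2 * (1 - b / 3))"
    using assms by (intro divide_left_mono) auto
  finally show ?thesis by simp
next
  case False
  then have y: "0 < y" "y < 3" using assms by auto
  have fact_ge: "2 * 3 ^ n \<le> (fact (n + 2) :: real)" for n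
  proof (induction n)
    case (Suc n)
    have "2 * 3 ^ Suc n \<le> 3 * (fact (n + 2) :: real)"
      using Suc unfolding power_Suc by linarith
    also have "\<dots> \<le> real (Suc (n + 2)) * fact (n + 2)" by (intro mult_right_mono) auto
    also have "\<dots> = fact (Suc n + 2)" by (simp only: fact_Suc[symmetric] add_Suc)
    finally show ?case .
  qed (simp add: numeral_eq_Suc)
  have sm: "(\<lambda>n. y\<^sup>2 / 2 * (y / 3) ^ n) sums (y\<^sup>2 / 2 * (1 / (1 - y / 3)))"
    using y by (intro sums_mult geometric_sums) auto
  have "exp y = 1 + y + (\<Sum>n. inverse (fact (n + 2)) *\<^sub>R (y ^ (n + 2)))"
    by (rule exp_first_two_terms)
  also have "(\<Sum>n. inverse (fact (n + 2)) *\<^sub>R (y ^ (n + 2))) \<le> (\<Sum>n. y\<^sup>2 / 2 * (y / 3) ^ n)"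
  proof (rule suminf_le)
    fix n
    have "inverse (fact (n + 2)) \<le> inverse (2 * 3 ^ n :: real)"
      using fact_ge by (intro le_imp_inverse_le) auto
    then have "inverse (fact (n + 2)) * y ^ (n + 2) \<le> inverse (2 * 3 ^ n) * y ^ (n + 2)"
      using y by (intro mult_right_mono) auto
    then show "inverse (fact (n + 2)) *\<^sub>R (y ^ (n + 2)) \<le> y\<^sup>2 / 2 * (y / 3) ^ n"
      by (simp add: field_simps power_divide power_add power2_eq_square)
  next
    show "summable (\<lambda>n. inverse (fact (n + 2)) *\<^sub>R (y ^ (n + 2)))"
      using summable_ignore_initial_segment[OF summable_exp_generic[of y], of 2]
      by simp
  qed (use sm in \<open>auto simp: sums_iff\<close>)
  also have "\<dots> = y\<^sup>2 / (2 * (1 - y / 3))"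
    using sums_unique[OF sm] by (simp add: field_simps)
  also have "\<dots> \<le> y\<^sup>2 / (2 * (1 - b / 3))"
    using assms y by (intro divide_left_mono) auto
  finally show ?thesis by simp
qed

section \<open>Expectations and conditioning for probability mass functions\<close>

lemma integrable_measure_pmf_bounded:
  fixes f :: "'a \<Rightarrow> real"
  assumes "\<And>x. x \<in> set_pmf M \<Longrightarrow> \<bar>f x\<bar> \<le> K"
  shows "integrable (measure_pmf M) f"
  by (rule measure_pmf.integrable_const_bound[where B = K]) (auto simp: AE_measure_pmf_iff assms)

text \<open>Adding \<open>K\<close> makes the integrand nonnegative on the support, where the
  formula for nonnegative integrals over \<open>bind_pmf\<close> applies. Boundedness keeps all real
  expectations finite, so the shift cancels at the end.\<close>

lemma expectation_bind_pmf:
  fixes f :: "'b \<Rightarrow> real"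
  assumes K: "\<And>y. y \<in> set_pmf (bind_pmf M N) \<Longrightarrow> \<bar>f y\<bar> \<le> K"
  shows "measure_pmf.expectation (bind_pmf M N) f =
    measure_pmf.expectation M (\<lambda>x. measure_pmf.expectation (N x) f)"
proof -
  define g where "g = (\<lambda>y. f y + K)"
  have K': "\<bar>f y\<bar> \<le> K" if "x \<in> set_pmf M" "y \<in> set_pmf (N x)" for x y
    using that K by auto
  have ge0: "0 \<le> g y" if "x \<in> set_pmf M" "y \<in> set_pmf (N x)" for x y
    using K'[OF that] by (simp add: g_def)
  have i0: "integrable (bind_pmf M N) f" and iN: "\<And>x. x \<in> set_pmf M \<Longrightarrow> integrable (N x) f"
    using K K' by (blast intro: integrable_measure_pmf_bounded)+
  have bN: "\<bar>measure_pmf.expectation (N x) f\<bar> \<le> K" if "x \<in> set_pmf M" for x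
    using K'[OF that] by (intro abs_leI measure_pmf.integral_le_const)
      (auto simp: AE_measure_pmf_iff iN that abs_le_iff minus_le_iff
        intro!: measure_pmf.integral_ge_const)
  have iM: "integrable M (\<lambda>x. measure_pmf.expectation (N x) f)"
    using bN by (rule integrable_measure_pmf_bounded)
  have "ennreal (measure_pmf.expectation (bind_pmf M N) g) = (\<integral>\<^sup>+y. g y \<partial>bind_pmf M N)"
    using i0 ge0 by (intro nn_integral_eq_integral[symmetric]) (auto simp: AE_measure_pmf_iff g_def)
  also have "\<dots> = (\<integral>\<^sup>+x. ennreal (measure_pmf.expectation (N x) g) \<partial>M)"
    unfolding nn_integral_bind_pmf using iN ge0
    by (intro nn_integral_cong_AE, subst AE_measure_pmf_iff, intro ballI nn_integral_eq_integral)
      (auto simp: AE_measure_pmf_iff g_def)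
  also have "\<dots> = ennreal (measure_pmf.expectation M (\<lambda>x. measure_pmf.expectation (N x) g))"
  proof (rule nn_integral_eq_integral)
    have eq: "measure_pmf.expectation (N x) g = measure_pmf.expectation (N x) f + K"
      if "x \<in> set_pmf M" for x
      using iN[OF that] by (simp add: g_def)
    then show "integrable M (\<lambda>x. measure_pmf.expectation (N x) g)"
      using bN by (intro integrable_measure_pmf_bounded[where K = "K + K"]) (fastforce simp: abs_le_iff)
    show "AE x in M. 0 \<le> measure_pmf.expectation (N x) g"
      using eq bN by (fastforce simp: AE_measure_pmf_iff abs_le_iff)
  qed
  finally have eq: "measure_pmf.expectation (bind_pmf M N) g =
      measure_pmf.expectation M (\<lambda>x. measure_pmf.expectation (N x) g)"
  proof (subst (asm) ennreal_inj)
    show "0 \<le> measure_pmf.expectation (bind_pmf M N) g"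
      using ge0 by (intro integral_nonneg_AE) (auto simp: AE_measure_pmf_iff)
    show "0 \<le> measure_pmf.expectation M (\<lambda>x. measure_pmf.expectation (N x) g)"
      using ge0 by (intro integral_nonneg_AE, subst AE_measure_pmf_iff, intro ballI integral_nonneg_AE)
        (auto simp: AE_measure_pmf_iff)
  qed
  have "measure_pmf.expectation M (\<lambda>x. measure_pmf.expectation (N x) g) =
      measure_pmf.expectation M (\<lambda>x. measure_pmf.expectation (N x) f + K)"
    using iN by (intro integral_cong_AE) (auto simp: AE_measure_pmf_iff g_def)
  with eq i0 iM show ?thesis
    by (simp add: g_def)
qed

text \<open>Both laws have total mass one, so comparing the complements of \<open>{x}\<close>
  reverses the inequality. This identifies the image of one conditional law under a Lipschitz
  injection with another.\<close>

lemma pmf_eqI_le: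
  assumes le: "\<And>x. pmf M x \<le> pmf N x"
  shows "M = N"
proof (rule pmf_eqI)
  fix x
  have sub: "measure_pmf.prob M A \<le> measure_pmf.prob N A" for A
  proof -
    have "emeasure M A \<le> emeasure N A"
      unfolding nn_integral_pmf[symmetric] by (intro nn_integral_mono) (simp add: le)
    then show ?thesis by (simp add: measure_pmf.emeasure_eq_measure)
  qed
  have "measure_pmf.prob N {x} \<le> measure_pmf.prob M {x}"
    using sub[of "- {x}"] measure_pmf.prob_compl[of "{x}" M] measure_pmf.prob_compl[of "{x}" N]
    by (simp add: Compl_eq_Diff_UNIV)
  then show "pmf M x = pmf N x"
    using le[of x] by (simp add: measure_pmf_single)
qed

lemma measure_cond_pmf:
  assumes A: "set_pmf M \<inter> A \<noteq> {}"
  shows "measure_pmf.prob (cond_pmf M A) B = measure_pmf.prob M (A \<inter> B) / measure_pmf.prob M A"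
proof -
  have pos: "measure_pmf.prob M A > 0"
    using A by (auto simp: zero_less_measure_iff measure_measure_pmf_not_zero)
  have "emeasure (cond_pmf M A) B = (\<integral>\<^sup>+ x. ennreal (pmf (cond_pmf M A) x) \<partial>count_space (A \<inter> B))"
    unfolding nn_integral_pmf[symmetric]
    by (simp add: nn_integral_count_space_indicator, intro nn_integral_cong)
      (auto simp: pmf_cond[OF A] split: split_indicator)
  also have "\<dots> =
      (\<integral>\<^sup>+ x. ennreal (1 / measure_pmf.prob M A) * ennreal (pmf M x) \<partial>count_space (A \<inter> B))"
    using pos by (intro nn_integral_cong) (auto simp: pmf_cond[OF A] ennreal_mult'[symmetric])
  also have "\<dots> = ennreal (1 / measure_pmf.prob M A) * emeasure M (A \<inter> B)"
    by (subst nn_integral_cmult) (auto simp: nn_integral_pmf)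
  also have "\<dots> = ennreal (measure_pmf.prob M (A \<inter> B) / measure_pmf.prob M A)"
    using pos by (simp add: measure_pmf.emeasure_eq_measure ennreal_mult'[symmetric])
  finally show ?thesis by (simp add: measure_pmf.emeasure_eq_measure)
qed

lemma cond_pmf_cond_pmf:
  assumes B: "set_pmf M \<inter> B \<noteq> {}" and "B \<subseteq> A"
  shows "cond_pmf (cond_pmf M A) B = cond_pmf M B"
proof (rule pmf_eqI)
  fix x
  have A: "set_pmf M \<inter> A \<noteq> {}" using assms by auto
  have AB: "set_pmf (cond_pmf M A) \<inter> B \<noteq> {}" using assms A by auto
  have "measure_pmf.prob M A \<noteq> 0"
    using A by (auto simp: measure_measure_pmf_not_zero)
  then show "pmf (cond_pmf (cond_pmf M A) B) x = pmf (cond_pmf M B) x"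
    using assms(2) by (auto simp: pmf_cond[OF A] pmf_cond[OF AB] pmf_cond[OF B] measure_cond_pmf[OF A] Int_absorb1)
qed

lemma expectation_affine_indicator:
  "measure_pmf.expectation M (\<lambda>x. if x \<in> A then c else (d :: real)) =
    c + (d - c) * measure_pmf.prob M (- A)"
proof -
  have "measure_pmf.expectation M (\<lambda>x. if x \<in> A then c else d) =
      measure_pmf.expectation M (\<lambda>x. c + (d - c) * indicator (- A) x)"
    by (intro Bochner_Integration.integral_cong) (auto simp: indicator_def)
  also have "\<dots> = c + (d - c) * measure_pmf.prob M (- A)"
    by (subst Bochner_Integration.integral_add)
      (auto intro!: integrable_measure_pmf_bounded[where K = 1] split: split_indicator)
  finally show ?thesis .
qed

section \<open>Exponential moment of a single centred increment\<close>

text \<open>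
  The hypothesis \<open>diff\<close> may be averaged over its first argument, which bounds the increments of
  \<open>g\<close> above by \<open>c + \<gamma> * (d - c)\<close>. Only the variance, which is computed around the value of \<open>g\<close> on
  the atom \<open>A\<close>, picks up the factor \<open>inverse (1 - p)\<close>.
\<close>

lemma expectation_exp_centered_le:
  fixes Q :: "'b pmf" and g h :: "'b \<Rightarrow> real"
  assumes h: "\<And>y. y \<in> set_pmf Q \<Longrightarrow> 0 \<le> h y \<and> h y \<le> 1"
    and Eh: "measure_pmf.expectation Q h \<le> \<gamma>"
    and diff: "\<And>y z. y \<in> set_pmf Q \<Longrightarrow> z \<in> set_pmf Q \<Longrightarrow> \<bar>g y - g z\<bar> \<le> c + (d - c) * h y"
    and cd: "c \<le> d"
    and p: "p < 1" and A: "measure_pmf.prob Q A \<ge> 1 - p"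
    and const: "\<And>y z. y \<in> set_pmf Q \<inter> A \<Longrightarrow> z \<in> set_pmf Q \<inter> A \<Longrightarrow> g y = g z \<and> h y = h z"
    and C: "c + \<gamma> * (d - c) \<le> C" and l: "0 \<le> l" "0 \<le> l * C" "l * C < 3"
  shows "measure_pmf.expectation Q (\<lambda>y. exp (l * (g y - measure_pmf.expectation Q g))) \<le>
    exp (l\<^sup>2 * (p * (c + \<gamma> * (d - c) * inverse (1 - p))\<^sup>2) / (2 * (1 - l * C / 3)))"
proof -
  let ?E = "measure_pmf.expectation Q"
  define m where "m = ?E g"
  define e where "e = \<gamma> * (d - c)"
  obtain y1 where y1: "y1 \<in> set_pmf Q" using set_pmf_not_empty by fast
  have hb: "c + (d - c) * h y \<le> d" if "y \<in> set_pmf Q" for y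
    using mult_left_mono[of "h y" 1 "d - c"] h[OF that] cd by simp
  have gdiff: "\<bar>g y - g z\<bar> \<le> d" if "y \<in> set_pmf Q" "z \<in> set_pmf Q" for y z
    using diff[OF that] hb[OF that(1)] by simp
  have gb: "\<bar>g y\<bar> \<le> \<bar>g y1\<bar> + d" if "y \<in> set_pmf Q" for y
    using gdiff[OF that y1] by simp
  have ig: "integrable Q g"
    using gb by (rule integrable_measure_pmf_bounded)
  have ih: "integrable Q h"
    using h by (intro integrable_measure_pmf_bounded[where K = 1]) simp
  have idl: "l * C < 3" "0 < 1 - l * C / 3" using l by auto
  have up: "g y - m \<le> C" if "y \<in> set_pmf Q" for y
  proof -
    have "g y - m = ?E (\<lambda>z. g y - g z)" using ig by (simp add: m_def)
    also have "\<dots> \<le> ?E (\<lambda>z. c + (d - c) * h z)"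
    proof (rule integral_mono_AE)
      show "AE z in Q. g y - g z \<le> c + (d - c) * h z"
        using diff[OF _ that] by (fastforce simp: AE_measure_pmf_iff)
    qed (use ig ih in auto)
    also have "\<dots> = c + (d - c) * ?E h" using ih by simp
    also have "\<dots> \<le> c + (d - c) * \<gamma>" using Eh cd by (intro add_left_mono mult_left_mono) auto
    also have "\<dots> \<le> C" using C by (simp add: mult.commute)
    finally show ?thesis .
  qed
  \<comment> \<open>This cruder two-sided bound serves to make the squared deviations
    integrable.\<close>
  have mb: "\<bar>g y - m\<bar> \<le> d" if "y \<in> set_pmf Q" for y
  proof -
    have "g y - m = ?E (\<lambda>z. g y - g z)" using ig by (simp add: m_def)
    also have "\<bar>\<dots>\<bar> \<le> ?E (\<lambda>z. \<bar>g y - g z\<bar>)" by (rule integral_abs_bound)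
    also have "\<dots> \<le> ?E (\<lambda>z. d)"
      using gdiff[OF that] ig by (intro integral_mono_AE) (auto simp: AE_measure_pmf_iff)
    finally show ?thesis by simp
  qed
  have isq: "integrable Q (\<lambda>y. (g y - a)\<^sup>2)" if "\<And>y. y \<in> set_pmf Q \<Longrightarrow> \<bar>g y - a\<bar> \<le> d" for a
  proof (rule integrable_measure_pmf_bounded)
    fix y assume "y \<in> set_pmf Q"
    from power_mono[OF that[OF this] abs_ge_zero, of 2] show "\<bar>(g y - a)\<^sup>2\<bar> \<le> d\<^sup>2" by simp
  qed
  have X0: "?E (\<lambda>y. g y - m) = 0" and iX: "integrable Q (\<lambda>y. g y - m)"
    using ig by (simp_all add: m_def)
  note iX2 = isq[OF mb]
  have "measure_pmf.prob Q A > 0" using A p by linarith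
  then obtain y0 where y0: "y0 \<in> set_pmf Q" "y0 \<in> A"
    unfolding zero_less_measure_iff measure_measure_pmf_not_zero[symmetric]
    using measure_pmf_zero_iff[of Q A] by auto
  define H where "H = c + (d - c) * h y0"
  have H0: "0 \<le> H" using diff[OF y0(1) y0(1)] by (simp add: H_def)
  \<comment> \<open>Markov's inequality on the atom: \<open>h\<close> equals \<open>h y0\<close> on
    the support within \<open>A\<close>, and \<open>A\<close> has probability at least
    \<open>1 - p\<close>. Dividing by \<open>1 - p\<close> produces the factor
    \<open>inverse (1 - p)\<close>.\<close>
  have "h y0 * (1 - p) \<le> h y0 * measure_pmf.prob Q A"
    using A h[OF y0(1)] by (intro mult_left_mono) auto
  also have "\<dots> = ?E (\<lambda>y. h y0 * indicator A y)" by simp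
  also have "\<dots> \<le> ?E h"
  proof (rule integral_mono_AE)
    have "h y0 * indicator A y \<le> h y" if "y \<in> set_pmf Q" for y
      using const[of y y0] y0 that h[OF that] by (auto split: split_indicator)
    then show "AE y in Q. h y0 * indicator A y \<le> h y"
      by (simp add: AE_measure_pmf_iff)
  qed (use ih in \<open>auto intro!: integrable_measure_pmf_bounded[where K = 1] split: split_indicator\<close>)
  finally have "h y0 * (1 - p) \<le> \<gamma>" using Eh by simp
  then have "h y0 \<le> \<gamma> * inverse (1 - p)"
    using p by (simp add: field_simps)
  then have "H \<le> c + (d - c) * (\<gamma> * inverse (1 - p))"
    unfolding H_def using cd by (intro add_left_mono mult_left_mono) auto
  then have He: "H \<le> c + e * inverse (1 - p)" by (simp add: e_def mult_ac)
  have p0: "0 \<le> p" using A measure_pmf.prob_le_1[of Q A] by linarith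
  \<comment> \<open>The variance is at most the second moment around any point. Around
    \<open>g y0\<close> the deviation vanishes on \<open>A\<close> and is at most \<open>H\<close>
    off \<open>A\<close>, a set of probability at most \<open>p\<close>.\<close>
  have "?E (\<lambda>y. (g y - m)\<^sup>2) \<le> ?E (\<lambda>y. (g y - m)\<^sup>2) + (m - g y0)\<^sup>2" by simp
  also have "\<dots> = ?E (\<lambda>y. (g y - m)\<^sup>2 + 2 * (m - g y0) * (g y - m) + (m - g y0)\<^sup>2)"
    using X0 iX iX2 by (simp del: Bochner_Integration.integral_diff)
  also have "\<dots> = ?E (\<lambda>y. (g y - g y0)\<^sup>2)"
    by (intro Bochner_Integration.integral_cong refl) (simp add: power2_eq_square algebra_simps)
  also have "\<dots> \<le> ?E (\<lambda>y. H\<^sup>2 * indicator (- A) y)"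
  proof (rule integral_mono_AE)
    have "(g y - g y0)\<^sup>2 \<le> H\<^sup>2 * indicator (- A) y" if "y \<in> set_pmf Q" for y
    proof (cases "y \<in> A")
      case True then show ?thesis using const[of y y0] y0 that by simp
    next
      case False then show ?thesis
        using diff[OF y0(1) that] H0 by (simp add: H_def abs_minus_commute flip: abs_le_square_iff)
    qed
    then show "AE y in Q. (g y - g y0)\<^sup>2 \<le> H\<^sup>2 * indicator (- A) y"
      by (auto simp: AE_measure_pmf_iff)
  qed (use isq[OF gdiff[OF _ y0(1)]] in
    \<open>auto intro!: integrable_measure_pmf_bounded[where K = 1] split: split_indicator\<close>)
  also have "\<dots> = H\<^sup>2 * measure_pmf.prob Q (- A)" by simp
  also have "\<dots> \<le> H\<^sup>2 * p"
    using A measure_pmf.prob_compl[of A Q]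
    by (intro mult_left_mono) (auto simp: Compl_eq_Diff_UNIV)
  also have "\<dots> \<le> (c + e * inverse (1 - p))\<^sup>2 * p"
    using He H0 p0 by (intro mult_right_mono power_mono) auto
  finally have var: "?E (\<lambda>y. (g y - m)\<^sup>2) \<le> p * (c + e * inverse (1 - p))\<^sup>2"
    by (simp add: mult.commute)
  have iexp: "integrable Q (\<lambda>y. exp (l * (g y - m)))"
    using mult_left_mono[OF up l(1)]
    by (intro integrable_measure_pmf_bounded[where K = "exp (l * C)"]) auto
  \<comment> \<open>After integration the linear term vanishes, and only the variance
    remains.\<close>
  have "?E (\<lambda>y. exp (l * (g y - m))) \<le>
      ?E (\<lambda>y. 1 + l * (g y - m) + l\<^sup>2 * (g y - m)\<^sup>2 / (2 * (1 - l * C / 3)))"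
  proof (rule integral_mono_AE)
    show "AE y in Q. exp (l * (g y - m)) \<le>
        1 + l * (g y - m) + l\<^sup>2 * (g y - m)\<^sup>2 / (2 * (1 - l * C / 3))"
      using exp_le_quadratic[OF mult_left_mono[OF up l(1)] l(2,3)]
      by (auto simp: AE_measure_pmf_iff power_mult_distrib)
  qed (use iexp iX iX2 in auto)
  also have "\<dots> = 1 + l\<^sup>2 * ?E (\<lambda>y. (g y - m)\<^sup>2) / (2 * (1 - l * C / 3))"
    using X0 iX iX2 by (simp del: Bochner_Integration.integral_diff)
  also have "\<dots> \<le> 1 + l\<^sup>2 * (p * (c + e * inverse (1 - p))\<^sup>2) / (2 * (1 - l * C / 3))"
    using idl(2)
    by (intro add_left_mono divide_right_mono mult_left_mono var zero_le_power2
        mult_nonneg_nonneg less_imp_le[OF idl(2)]) simp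
  also have "\<dots> \<le> exp (l\<^sup>2 * (p * (c + e * inverse (1 - p))\<^sup>2) / (2 * (1 - l * C / 3)))"
    by (rule exp_ge_add_one_self)
  finally show ?thesis by (simp add: m_def e_def)
qed

section \<open>The martingale of conditional expectations given initial segments\<close>

definition agree :: "nat \<Rightarrow> (nat \<Rightarrow> 'a) \<Rightarrow> (nat \<Rightarrow> 'a) set" where
  "agree k x = {y. \<forall>j\<in>{1..k}. y j = x j}"

text \<open>The conditional law is indexed by a whole outcome \<open>x\<close>, so that it is a
  kernel on the same space. It is meaningful only if the first \<open>k\<close> coordinates of
  \<open>x\<close> are possible; later lemmas therefore mostly take \<open>x\<close> from the
  support.\<close>

definition cond_prefix :: "(nat \<Rightarrow> 'a) pmf \<Rightarrow> nat \<Rightarrow> (nat \<Rightarrow> 'a) \<Rightarrow> (nat \<Rightarrow> 'a) pmf" where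
  "cond_prefix P k x = cond_pmf P (agree k x)"

text \<open>As a function of the outcome, this is the Doob martingale \<open>Y\<^sub>k\<close> of
  \<open>f\<close>; at \<open>k = 0\<close> it is the plain expectation.\<close>

abbreviation cexp ::
  "(nat \<Rightarrow> 'a) pmf \<Rightarrow> ((nat \<Rightarrow> 'a) \<Rightarrow> real) \<Rightarrow> nat \<Rightarrow> (nat \<Rightarrow> 'a) \<Rightarrow> real" where
  "cexp P f k x \<equiv> measure_pmf.expectation (cond_prefix P k x) f"

lemma agree_refl [simp]: "x \<in> agree k x"
  by (simp add: agree_def)

lemma agree_cong: "y \<in> agree k x \<Longrightarrow> j \<le> k \<Longrightarrow> agree j y = agree j x"
  by (fastforce simp: agree_def)

lemma agree_mono: "y \<in> agree k x \<Longrightarrow> j \<le> k \<Longrightarrow> y \<in> agree j x"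
  by (auto simp: agree_def)

lemma agree_sym: "y \<in> agree k x \<longleftrightarrow> x \<in> agree k y"
  by (auto simp: agree_def)

lemma cond_prefix_cong: "y \<in> agree k x \<Longrightarrow> j \<le> k \<Longrightarrow> cond_prefix P j y = cond_prefix P j x"
  by (simp add: cond_prefix_def agree_cong)

lemma set_agree_nonempty: "x \<in> set_pmf P \<Longrightarrow> set_pmf P \<inter> agree k x \<noteq> {}"
  using agree_refl by blast

lemma set_cond_prefix: "x \<in> set_pmf P \<Longrightarrow> set_pmf (cond_prefix P k x) = set_pmf P \<inter> agree k x"
  unfolding cond_prefix_def by (rule set_cond_pmf) (rule set_agree_nonempty)

lemma cond_prefix_0 [simp]: "cond_prefix P 0 x = P"
  unfolding cond_prefix_def by (rule pmf_eqI) (simp add: agree_def pmf_cond set_pmf_not_empty)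

text \<open>The tower property in kernel form. Agreement up to \<open>k\<close> is an equivalence
  relation refining agreement up to \<open>j\<close>; drawing an outcome and then redrawing it
  within its class leaves the law unchanged.\<close>

lemma bind_cond_prefix:
  assumes x: "x \<in> set_pmf P" and jk: "j \<le> k"
  shows "bind_pmf (cond_prefix P j x) (cond_prefix P k) = cond_prefix P j x"
proof -
  let ?Q = "cond_prefix P j x"
  have Q: "set_pmf ?Q = set_pmf P \<inter> agree j x" by (rule set_cond_prefix[OF x])
  have "bind_pmf ?Q (cond_prefix P k) = bind_pmf ?Q (\<lambda>y. cond_pmf ?Q {z. z \<in> agree k y})"
  proof (rule bind_pmf_cong[OF refl])
    fix y assume y: "y \<in> set_pmf ?Q"
    then have yP: "y \<in> set_pmf P" by (simp add: Q)
    have "agree k y \<subseteq> agree j x"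
      using y jk unfolding Q by (auto simp: agree_def)
    then show "cond_prefix P k y = cond_pmf ?Q {z. z \<in> agree k y}"
      using set_agree_nonempty[OF yP] by (simp add: cond_prefix_def cond_pmf_cond_pmf)
  qed
  also have "\<dots> = ?Q"
  proof (rule bind_cond_pmf_cancel)
    fix y assume "y \<in> set_pmf ?Q"
    then show "set_pmf ?Q \<inter> {z. z \<in> agree k y} \<noteq> {}" "set_pmf ?Q \<inter> {z. y \<in> agree k z} \<noteq> {}"
      using agree_refl by blast+
  next
    fix y z assume "y \<in> set_pmf ?Q" "z \<in> agree k y"
    then have "{w. w \<in> agree k y} = {w. z \<in> agree k w}"
      by (auto simp: agree_def)
    then show "measure_pmf.prob ?Q {w. w \<in> agree k y} = measure_pmf.prob ?Q {w. z \<in> agree k w}"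
      by simp
  qed
  finally show ?thesis .
qed

lemma cexp_tower:
  assumes x: "x \<in> set_pmf P" and jk: "j \<le> k" and K: "\<And>y. y \<in> set_pmf P \<Longrightarrow> \<bar>f y\<bar> \<le> K"
  shows "cexp P (cexp P f k) j x = cexp P f j x"
proof -
  have "cexp P f j x = measure_pmf.expectation (bind_pmf (cond_prefix P j x) (cond_prefix P k)) f"
    by (simp add: bind_cond_prefix[OF x jk])
  also have "\<dots> = cexp P (cexp P f k) j x"
    using K by (intro expectation_bind_pmf[where K = K])
      (simp add: bind_cond_prefix[OF x jk] set_cond_prefix[OF x])
  finally show ?thesis by simp
qed

lemma cexp_abs_le:
  assumes x: "x \<in> set_pmf P" and K: "\<And>y. y \<in> set_pmf P \<Longrightarrow> \<bar>f y\<bar> \<le> K"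
  shows "\<bar>cexp P f k x\<bar> \<le> K"
proof -
  have K': "\<bar>f y\<bar> \<le> K" if "y \<in> set_pmf (cond_prefix P k x)" for y
    using that K by (simp add: set_cond_prefix[OF x])
  then have i: "integrable (cond_prefix P k x) f"
    by (rule integrable_measure_pmf_bounded)
  have "\<bar>cexp P f k x\<bar> \<le> cexp P (\<lambda>y. \<bar>f y\<bar>) k x" by (rule integral_abs_bound)
  also have "\<dots> \<le> K"
    using i K' by (intro measure_pmf.integral_le_const) (auto simp: AE_measure_pmf_iff)
  finally show ?thesis .
qed

text \<open>The last increment is peeled off: given the first \<open>n\<close> coordinates, the sum
  of the earlier increments is constant and leaves the conditional expectation, and
  \<open>step\<close> bounds the remaining factor. The bound \<open>K\<close> provides
  integrability.\<close>

lemma exp_moment_le: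
  assumes adapted: "\<And>j x y. j \<in> {1..N} \<Longrightarrow> x \<in> set_pmf P \<Longrightarrow> y \<in> set_pmf P \<inter> agree j x \<Longrightarrow> D j y = D j x"
    and K: "\<And>j x. j \<in> {1..N} \<Longrightarrow> x \<in> set_pmf P \<Longrightarrow> \<bar>D j x\<bar> \<le> K"
    and step: "\<And>j x. j \<in> {1..N} \<Longrightarrow> x \<in> set_pmf P \<Longrightarrow> cexp P (\<lambda>y. exp (D j y)) (j - 1) x \<le> exp (w j)"
    and "n \<le> N"
  shows "measure_pmf.expectation P (\<lambda>x. exp (\<Sum>j\<in>{1..n}. D j x)) \<le> exp (\<Sum>j\<in>{1..n}. w j)"
  using \<open>n \<le> N\<close>
proof (induction n)
  case (Suc n)
  define S where "S = (\<lambda>m x. \<Sum>j\<in>{1..m}. D j x)"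
  have Sb: "\<bar>S m x\<bar> \<le> real m * K" if "m \<le> N" "x \<in> set_pmf P" for m x
  proof -
    have "\<bar>S m x\<bar> \<le> (\<Sum>j\<in>{1..m}. \<bar>D j x\<bar>)" unfolding S_def by (rule sum_abs)
    also have "\<dots> \<le> (\<Sum>j\<in>{1..m}. K)" using K that by (intro sum_mono) auto
    finally show ?thesis by simp
  qed
  have eSb: "\<bar>exp (S m x)\<bar> \<le> exp (real m * K)" if "m \<le> N" "x \<in> set_pmf P" for m x
    using Sb[OF that] by simp
  obtain x0 where x0: "x0 \<in> set_pmf P" using set_pmf_not_empty by fast
  have "measure_pmf.expectation P (\<lambda>x. exp (S (Suc n) x)) =
      measure_pmf.expectation P (cexp P (\<lambda>x. exp (S (Suc n) x)) n)"
    using cexp_tower[OF x0 le0[of n] eSb[OF Suc.prems]] by simp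
  also have "\<dots> \<le> measure_pmf.expectation P (\<lambda>x. exp (S n x) * exp (w (Suc n)))"
  proof (rule integral_mono_AE)
    show "integrable P (cexp P (\<lambda>x. exp (S (Suc n) x)) n)"
      using cexp_abs_le[OF _ eSb[OF Suc.prems]] by (rule integrable_measure_pmf_bounded)
    show "integrable P (\<lambda>x. exp (S n x) * exp (w (Suc n)))"
      using eSb[of n] Suc.prems
      by (intro integrable_mult_left integrable_measure_pmf_bounded[where K = "exp (real n * K)"]) auto
    have "cexp P (\<lambda>x. exp (S (Suc n) x)) n x \<le> exp (S n x) * exp (w (Suc n))"
      if x: "x \<in> set_pmf P" for x
    proof -
      have "S n y = S n x" if "y \<in> set_pmf P \<inter> agree n x" for y
        unfolding S_def using that Suc.prems x
        by (intro sum.cong refl adapted) (auto intro: agree_mono)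
      then have "cexp P (\<lambda>x. exp (S (Suc n) x)) n x = cexp P (\<lambda>y. exp (S n x) * exp (D (Suc n) y)) n x"
        by (intro integral_cong_AE)
          (auto simp: AE_measure_pmf_iff set_cond_prefix[OF x] S_def exp_add)
      also have "\<dots> = exp (S n x) * cexp P (\<lambda>y. exp (D (Suc n) y)) n x" by simp
      also have "\<dots> \<le> exp (S n x) * exp (w (Suc n))"
        using step[of "Suc n" x] x Suc.prems by (intro mult_left_mono) auto
      finally show ?thesis .
    qed
    then show "AE x in P. cexp P (\<lambda>x. exp (S (Suc n) x)) n x \<le> exp (S n x) * exp (w (Suc n))"
      by (simp add: AE_measure_pmf_iff)
  qed
  also have "\<dots> = measure_pmf.expectation P (\<lambda>x. exp (S n x)) * exp (w (Suc n))"
    by simp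
  also have "\<dots> \<le> exp (\<Sum>j\<in>{1..n}. w j) * exp (w (Suc n))"
    using Suc by (intro mult_right_mono) (auto simp: S_def)
  finally show ?case by (simp add: S_def exp_add)
qed simp

section \<open>Consequences of the Lipschitz condition and of concentration\<close>

text \<open>Restates the Lipschitz condition in terms of classes of outcomes in the support:
  \<open>y\<close> supplies the common prefix and the value \<open>y k\<close>, while
  \<open>z\<close> supplies the competing value \<open>z k\<close>.\<close>

lemma Lipschitz_injection:
  assumes Lip: "general_Lipschitz P N \<Lambda> \<Gamma> f c d" and supp: "set_pmf P \<subseteq> PiE {1..N} \<Lambda>"
    and k: "k \<in> {1..N}" and y: "y \<in> set_pmf P" and z: "z \<in> set_pmf P" and yz: "z \<in> agree (k - 1) y"
  obtains \<rho> where "inj_on \<rho> (set_pmf P \<inter> agree k y)"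
    and "\<And>x. x \<in> set_pmf P \<inter> agree k y \<Longrightarrow> \<rho> x \<in> set_pmf P \<inter> agree k z"
    and "\<And>x. x \<in> set_pmf P \<inter> agree k y \<Longrightarrow> \<bar>f x - f (\<rho> x)\<bar> \<le> (if x \<in> \<Gamma> then c k else d k)"
    and "\<And>x. x \<in> set_pmf P \<inter> agree k y \<Longrightarrow> pmf (cond_prefix P k y) x \<le> pmf (cond_prefix P k z) (\<rho> x)"
proof -
  have split: "{1..k} = insert k {1..k-1}" using k by auto
  have ext: "extensions P N \<Lambda> k y (w k) = set_pmf P \<inter> agree k w"
    if "w \<in> set_pmf P" "w \<in> agree (k - 1) y" for w
    using that supp unfolding extensions_def agree_def split
    by (auto simp: pmf_positive_iff)
  have poss: "possible P k (y(k := w k))" if "w \<in> set_pmf P" "w \<in> agree (k - 1) y" for w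
  proof -
    have "{x. \<forall>j\<in>{1..k}. x j = (y(k := w k)) j} = agree k w"
      using that(2) unfolding agree_def split by auto
    then show ?thesis
      unfolding possible_def using measure_pmf_posI[OF that(1) agree_refl] by simp
  qed
  \<comment> \<open>Intersecting the conditioning event with the support does not change its
    probability, so this is the conditional law of \<open>cond_prefix\<close>.\<close>
  have cond: "\<P>(v in P. v = x \<bar> v \<in> set_pmf P \<inter> agree k w) = pmf (cond_prefix P k w) x"
    if "w \<in> set_pmf P" "x \<in> set_pmf P \<inter> agree k w" for w x
  proof -
    have "{v. v = x \<and> v \<in> set_pmf P \<inter> agree k w} = {x}" using that by auto
    moreover have "{v. v \<in> set_pmf P \<inter> agree k w} = agree k w \<inter> set_pmf P" by auto
    ultimately show ?thesis
      using that pmf_cond[OF set_agree_nonempty[OF that(1)], of k x]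
      by (simp add: cond_prob_def cond_prefix_def measure_Int_set_pmf measure_pmf_single)
  qed
  have "\<exists>\<rho>. inj_on \<rho> (set_pmf P \<inter> agree k y) \<and> \<rho> ` (set_pmf P \<inter> agree k y) \<subseteq> set_pmf P \<inter> agree k z \<and>
      (\<forall>x\<in>set_pmf P \<inter> agree k y. \<bar>f x - f (\<rho> x)\<bar> \<le> (if x \<in> \<Gamma> then c k else d k) \<and>
        \<P>(v in P. v = x \<bar> v \<in> set_pmf P \<inter> agree k y) \<le> \<P>(v in P. v = \<rho> x \<bar> v \<in> set_pmf P \<inter> agree k z))"
    using Lip k poss[OF y] poss[OF z yz]
    unfolding general_Lipschitz_def Let_def ext[OF y agree_refl, symmetric] ext[OF z yz, symmetric]
    by simp
  then obtain \<rho> where \<rho>: "inj_on \<rho> (set_pmf P \<inter> agree k y)"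
      "\<rho> ` (set_pmf P \<inter> agree k y) \<subseteq> set_pmf P \<inter> agree k z"
      "\<forall>x\<in>set_pmf P \<inter> agree k y. \<bar>f x - f (\<rho> x)\<bar> \<le> (if x \<in> \<Gamma> then c k else d k) \<and>
        \<P>(v in P. v = x \<bar> v \<in> set_pmf P \<inter> agree k y) \<le> \<P>(v in P. v = \<rho> x \<bar> v \<in> set_pmf P \<inter> agree k z)"
    by blast
  have im: "\<rho> x \<in> set_pmf P \<inter> agree k z" if "x \<in> set_pmf P \<inter> agree k y" for x
    using \<rho>(2) that by blast
  have le: "pmf (cond_prefix P k y) x \<le> pmf (cond_prefix P k z) (\<rho> x)"
    if "x \<in> set_pmf P \<inter> agree k y" for x
    using \<rho>(3) that cond[OF y that] cond[OF z im[OF that]] by metis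
  show thesis
    using that[of \<rho>, OF \<rho>(1) im _ le] \<rho>(3) by blast
qed

text \<open>By \<open>pmf_eqI_le\<close>, the injection carries the conditional law of
  \<open>y\<close> onto that of \<open>z\<close>. Both expectations thus become integrals over the
  first law, with integrands differing by at most \<open>c k\<close> on \<open>\<Gamma>\<close> and
  \<open>d k\<close> elsewhere.\<close>

lemma Lipschitz_cexp_diff:
  assumes Lip: "general_Lipschitz P N \<Lambda> \<Gamma> f c d" and supp: "set_pmf P \<subseteq> PiE {1..N} \<Lambda>"
    and k: "k \<in> {1..N}" and y: "y \<in> set_pmf P" and z: "z \<in> set_pmf P" and yz: "z \<in> agree (k - 1) y"
    and K: "\<And>x. x \<in> set_pmf P \<Longrightarrow> \<bar>f x\<bar> \<le> K"
  shows "\<bar>cexp P f k y - cexp P f k z\<bar> \<le>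
    c k + (d k - c k) * measure_pmf.prob (cond_prefix P k y) (- \<Gamma>)"
proof -
  let ?Q = "cond_prefix P k y" and ?R = "cond_prefix P k z"
  obtain \<rho> where inj: "inj_on \<rho> (set_pmf P \<inter> agree k y)"
    and im: "\<And>x. x \<in> set_pmf P \<inter> agree k y \<Longrightarrow> \<rho> x \<in> set_pmf P \<inter> agree k z"
    and fle: "\<And>x. x \<in> set_pmf P \<inter> agree k y \<Longrightarrow> \<bar>f x - f (\<rho> x)\<bar> \<le> (if x \<in> \<Gamma> then c k else d k)"
    and le: "\<And>x. x \<in> set_pmf P \<inter> agree k y \<Longrightarrow> pmf ?Q x \<le> pmf ?R (\<rho> x)"
    using Lipschitz_injection[OF Lip supp k y z yz] by metis
  have sQ: "set_pmf ?Q = set_pmf P \<inter> agree k y" by (rule set_cond_prefix[OF y])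
  have eq: "map_pmf \<rho> ?Q = ?R"
  proof (rule pmf_eqI_le)
    fix w
    show "pmf (map_pmf \<rho> ?Q) w \<le> pmf ?R w"
    proof (cases "w \<in> \<rho> ` set_pmf ?Q")
      case True
      then show ?thesis using le inj by (auto simp: pmf_map_inj sQ)
    next
      case False
      then have "pmf (map_pmf \<rho> ?Q) w = 0" by (simp add: pmf_eq_0_set_pmf)
      then show ?thesis by simp
    qed
  qed
  have i1: "integrable ?Q f" and i2: "integrable ?Q (\<lambda>x. f (\<rho> x))"
    using K im by (auto intro!: integrable_measure_pmf_bounded[where K = K] simp: sQ)
  have "cexp P f k y - cexp P f k z = measure_pmf.expectation ?Q (\<lambda>x. f x - f (\<rho> x))"
    using i1 i2 by (simp flip: eq)
  also have "\<bar>\<dots>\<bar> \<le> measure_pmf.expectation ?Q (\<lambda>x. \<bar>f x - f (\<rho> x)\<bar>)"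
    by (rule integral_abs_bound)
  also have "\<dots> \<le> measure_pmf.expectation ?Q (\<lambda>x. if x \<in> \<Gamma> then c k else d k)"
  proof (rule integral_mono_AE)
    show "integrable ?Q (\<lambda>x. if x \<in> \<Gamma> then c k else d k)"
      by (rule integrable_measure_pmf_bounded[where K = "max \<bar>c k\<bar> \<bar>d k\<bar>"]) simp
    show "AE x in ?Q. \<bar>f x - f (\<rho> x)\<bar> \<le> (if x \<in> \<Gamma> then c k else d k)"
      unfolding AE_measure_pmf_iff sQ using fle by blast
  qed (use i1 i2 in auto)
  also have "\<dots> = c k + (d k - c k) * measure_pmf.prob ?Q (- \<Gamma>)"
    by (rule expectation_affine_indicator)
  finally show ?thesis .
qed

text \<open>This makes \<open>f\<close> bounded on the support, and hence all its expectations
  finite. Among outcomes agreeing except in the last \<open>Suc n\<close> coordinates, an injection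
  moves \<open>y\<close> at cost at most \<open>d k\<close> to a point that agrees with
  \<open>z\<close> in one more coordinate.\<close>

lemma Lipschitz_oscillation:
  assumes Lip: "general_Lipschitz P N \<Lambda> \<Gamma> f c d" and supp: "set_pmf P \<subseteq> PiE {1..N} \<Lambda>"
    and cd: "\<And>k. k \<in> {1..N} \<Longrightarrow> c k \<le> d k"
    and "n \<le> N" "y \<in> set_pmf P" "z \<in> set_pmf P" "z \<in> agree (N - n) y"
  shows "\<bar>f y - f z\<bar> \<le> (\<Sum>k\<in>{N-n<..N}. d k)"
  using assms(4-)
proof (induction n arbitrary: y z)
  case 0
  have "y = z"
  proof (rule PiE_ext)
    show "y \<in> PiE {1..N} \<Lambda>" "z \<in> PiE {1..N} \<Lambda>" using 0 supp by auto
  qed (use 0 in \<open>auto simp: agree_def\<close>)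
  then show ?case by simp
next
  case (Suc n)
  define k where "k = N - n"
  have k: "k \<in> {1..N}" and k1: "N - Suc n = k - 1" using Suc.prems(1) by (auto simp: k_def)
  obtain \<rho> where im: "\<And>x. x \<in> set_pmf P \<inter> agree k y \<Longrightarrow> \<rho> x \<in> set_pmf P \<inter> agree k z"
    and fle: "\<And>x. x \<in> set_pmf P \<inter> agree k y \<Longrightarrow> \<bar>f x - f (\<rho> x)\<bar> \<le> (if x \<in> \<Gamma> then c k else d k)"
    using Lipschitz_injection[OF Lip supp k Suc.prems(2,3)] Suc.prems(4) k1 by metis
  have "\<bar>f y - f z\<bar> \<le> \<bar>f y - f (\<rho> y)\<bar> + \<bar>f (\<rho> y) - f z\<bar>" by simp
  also have "\<bar>f y - f (\<rho> y)\<bar> \<le> d k"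
    using fle[of y] Suc.prems(2) cd[OF k] by (auto split: if_splits)
  also have "\<bar>f (\<rho> y) - f z\<bar> \<le> (\<Sum>k\<in>{N-n<..N}. d k)"
    using im[of y] Suc.prems by (intro Suc.IH) (auto simp: k_def agree_sym)
  also have "d k + (\<Sum>k\<in>{N-n<..N}. d k) = (\<Sum>k\<in>{N-Suc n<..N}. d k)"
  proof -
    have "{N-Suc n<..N} = insert k {N-n<..N}" using Suc.prems(1) by (auto simp: k_def)
    then show ?thesis by (simp add: k_def)
  qed
  finally show ?case by simp
qed

lemma concentrated_cond_prefix:
  assumes conc: "concentrated P N \<Lambda> p" and k: "k \<in> {1..N}" and x: "x \<in> set_pmf P"
  obtains \<eta> where "measure_pmf.prob (cond_prefix P (k - 1) x) {y. y k = \<eta>} \<ge> 1 - p k"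
proof -
  have "possible P (k - 1) x"
    using measure_pmf_posI[OF x agree_refl] by (simp add: possible_def agree_def)
  then obtain \<eta> where "\<P>(y in P. y k = \<eta> \<bar> \<forall>j\<in>{1..k-1}. y j = x j) \<ge> 1 - p k"
    using conc k unfolding concentrated_def by blast
  moreover have "{y. y k = \<eta> \<and> (\<forall>j\<in>{1..k-1}. y j = x j)} = agree (k - 1) x \<inter> {y. y k = \<eta>}"
    by (auto simp: agree_def)
  moreover have "{y. \<forall>j\<in>{1..k-1}. y j = x j} = agree (k - 1) x"
    by (simp add: agree_def)
  ultimately show thesis
    using that[of \<eta>] measure_cond_pmf[OF set_agree_nonempty[OF x], of "k - 1" "{y. y k = \<eta>}"]
    by (simp add: cond_prob_def cond_prefix_def)
qed

section \<open>Bernstein tail bound outside the bad event\<close>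

text \<open>The usual choice \<open>l = t / (V + C * t / 3)\<close> turns
  \<open>1 - l * C / 3\<close> into \<open>V / W\<close>, after which the two terms combine to the
  claimed exponent exactly.\<close>

lemma bernstein_exponent:
  fixes V C t :: real
  assumes V: "0 \<le> V" and C: "0 < C" and t: "0 < t"
  obtains l where "0 \<le> l" "l * C < 3"
    "l\<^sup>2 * V / (2 * (1 - l * C / 3)) - l * t \<le> - (t\<^sup>2 / (2 * V + 2 * C * t / 3))"
proof (cases "V = 0")
  case True
  \<comment> \<open>For \<open>V = 0\<close> the usual choice would give \<open>l * C = 3\<close>,
    which is excluded; half of that value attains the claimed exponent.\<close>
  show thesis
    using C t True by (intro that[of "3 / (2 * C)"]) (auto simp: field_simps power2_eq_square)
next
  case False
  define W where "W = V + C * t / 3"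
  have W: "0 < V" "0 < W" using V False C t by (auto simp: W_def add_pos_pos)
  have one: "1 - t / W * C / 3 = V / W"
    using W by (simp add: W_def field_simps)
  show thesis
  proof (rule that[of "t / W"])
    show "0 \<le> t / W" using t W by simp
    show "t / W * C < 3" using W one by (simp add: field_simps W_def)
    have a: "(t / W)\<^sup>2 * V / (2 * (V / W)) = t\<^sup>2 / (2 * W)"
      using W by (simp add: field_simps power2_eq_square)
    have b: "t / W * t = 2 * (t\<^sup>2 / (2 * W))" by (simp add: power2_eq_square)
    have c: "2 * V + 2 * C * t / 3 = 2 * W" by (simp add: W_def)
    show "(t / W)\<^sup>2 * V / (2 * (1 - t / W * C / 3)) - t / W * t
        \<le> - (t\<^sup>2 / (2 * V + 2 * C * t / 3))"
      unfolding one a b c by simp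
  qed
qed

text \<open>
  Conditioning on \<open>k - 1\<close> (not \<open>k\<close>) coordinates makes the truncation of the martingale predictable,
  so that truncated increments still have conditional mean zero.
\<close>

definition bad_event ::
  "(nat \<Rightarrow> 'a) pmf \<Rightarrow> nat \<Rightarrow> (nat \<Rightarrow> 'a set) \<Rightarrow> (nat \<Rightarrow> 'a) set \<Rightarrow> (nat \<Rightarrow> real) \<Rightarrow> (nat \<Rightarrow> 'a) set" where
  "bad_event P N \<Lambda> \<Gamma> \<gamma> = {x \<in> PiE {1..N} \<Lambda>. x \<notin> \<Gamma> \<or>
     (\<exists>k\<in>{1..N}. \<gamma> k < measure_pmf.prob (cond_prefix P (k - 1) x) (- \<Gamma>))}"

text \<open>There are \<open>N + 1\<close> events but only \<open>N\<close> terms. For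
  \<open>k = 1\<close> the conditional probability is the constant \<open>q\<close>: if it exceeds
  \<open>\<gamma> 1\<close>, the first term alone is at least one; otherwise that event is empty and
  its term pays for the complement of \<open>\<Gamma>\<close>, as
  \<open>\<gamma> 1 \<le> 1\<close>.\<close>

lemma prob_bad_event_le:
  assumes N: "N \<ge> 1" and \<gamma>: "\<And>k. k \<in> {1..N} \<Longrightarrow> 0 < \<gamma> k \<and> \<gamma> k \<le> 1"
  shows "measure_pmf.prob P (bad_event P N \<Lambda> \<Gamma> \<gamma>) \<le>
    (\<Sum>k\<in>{1..N}. inverse (\<gamma> k) * measure_pmf.prob P (- \<Gamma>))"
proof -
  define q where "q = measure_pmf.prob P (- \<Gamma>)"
  define h where "h = (\<lambda>k x. measure_pmf.prob (cond_prefix P k x) (- \<Gamma>))"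
  have split: "{1..N} = insert 1 {2..N}" using N by auto
  have pos: "0 \<le> inverse (\<gamma> k) * q" if "k \<in> {1..N}" for k
    using \<gamma>[OF that] by (simp add: q_def)
  have markov: "measure_pmf.prob P {x. \<gamma> k \<le> h j x} \<le> inverse (\<gamma> k) * q" if "k \<in> {1..N}" for j k
  proof -
    obtain x0 where x0: "x0 \<in> set_pmf P" using set_pmf_not_empty by fast
    have "measure_pmf.expectation P (h j) = q"
      using cexp_tower[OF x0 le0[of j], of "indicator (- \<Gamma>)" 1] by (simp add: h_def q_def)
    moreover have "integrable P (h j)"
      by (rule integrable_measure_pmf_bounded[where K = 1]) (simp add: h_def)
    ultimately show ?thesis
      using integral_Markov_inequality_measure[of "measure_pmf P" "h j" UNIV "\<gamma> k"] \<gamma>[OF that]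
      by (simp add: h_def field_simps)
  qed
  show ?thesis
  proof (cases "\<gamma> 1 < q")
    case True
    have "measure_pmf.prob P (bad_event P N \<Lambda> \<Gamma> \<gamma>) \<le> 1" by simp
    also have "1 \<le> inverse (\<gamma> 1) * q"
      using True \<gamma>[of 1] N by (simp add: field_simps)
    also have "\<dots> \<le> (\<Sum>k\<in>{1..N}. inverse (\<gamma> k) * q)"
      using pos N by (intro member_le_sum) auto
    finally show ?thesis by (simp add: q_def)
  next
    case False
    have "bad_event P N \<Lambda> \<Gamma> \<gamma> \<subseteq> - \<Gamma> \<union> (\<Union>k\<in>{2..N}. {x. \<gamma> k \<le> h (k - 1) x})"
    proof
      fix x assume "x \<in> bad_event P N \<Lambda> \<Gamma> \<gamma>"
      then consider "x \<notin> \<Gamma>" | k where "k \<in> {1..N}" "\<gamma> k < h (k - 1) x"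
        by (auto simp: bad_event_def h_def)
      then show "x \<in> - \<Gamma> \<union> (\<Union>k\<in>{2..N}. {x. \<gamma> k \<le> h (k - 1) x})"
      proof cases
        case 2
        then have "k \<noteq> 1" using False by (auto simp: h_def q_def)
        then have "k \<in> {2..N}" using 2(1) by simp
        then show ?thesis using 2(2) by (auto intro: less_imp_le)
      qed simp
    qed
    then have "measure_pmf.prob P (bad_event P N \<Lambda> \<Gamma> \<gamma>) \<le>
        measure_pmf.prob P (- \<Gamma> \<union> (\<Union>k\<in>{2..N}. {x. \<gamma> k \<le> h (k - 1) x}))"
      by (intro measure_pmf.finite_measure_mono) auto
    also have "\<dots> \<le> q + measure_pmf.prob P (\<Union>k\<in>{2..N}. {x. \<gamma> k \<le> h (k - 1) x})"
      unfolding q_def by (rule measure_Un_le) auto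
    also have "\<dots> \<le> q + (\<Sum>k\<in>{2..N}. measure_pmf.prob P {x. \<gamma> k \<le> h (k - 1) x})"
      by (intro add_left_mono measure_pmf.finite_measure_subadditive_finite) auto
    also have "\<dots> \<le> inverse (\<gamma> 1) * q + (\<Sum>k\<in>{2..N}. inverse (\<gamma> k) * q)"
    proof (intro add_mono sum_mono markov)
      have "1 * q \<le> inverse (\<gamma> 1) * q"
        using \<gamma>[of 1] N by (intro mult_right_mono) (auto simp: q_def one_le_inverse)
      then show "q \<le> inverse (\<gamma> 1) * q" by simp
    qed auto
    also have "\<dots> = (\<Sum>k\<in>{1..N}. inverse (\<gamma> k) * q)"
      unfolding split by simp
    finally show ?thesis by (simp add: q_def)
  qed
qed

text \<open>Chernoff's method for a fixed \<open>l\<close>: outside the bad event no increment is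
  removed, so the truncated sum telescopes to \<open>l * (f x - \<mu>)\<close>, and Markov's
  inequality is applied to its exponential.\<close>

lemma tail_bound:
  fixes C :: real
  assumes supp: "set_pmf P \<subseteq> PiE {1..N} \<Lambda>"
    and \<gamma>: "\<And>k. k \<in> {1..N} \<Longrightarrow> 0 < \<gamma> k"
    and p: "\<And>k. k \<in> {1..N} \<Longrightarrow> 0 \<le> p k \<and> p k < 1"
    and conc: "concentrated P N \<Lambda> p"
    and cd: "\<And>k. k \<in> {1..N} \<Longrightarrow> c k \<le> d k"
    and Lip: "general_Lipschitz P N \<Lambda> \<Gamma> f c d"
    and C: "\<And>k. k \<in> {1..N} \<Longrightarrow> c k + \<gamma> k * (d k - c k) \<le> C"
    and l: "0 \<le> l" "0 \<le> l * C" "l * C < 3"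
  shows "measure_pmf.prob P
      {x. f x \<ge> measure_pmf.expectation P f + t \<and> x \<notin> bad_event P N \<Lambda> \<Gamma> \<gamma>} \<le>
    exp (l\<^sup>2 * (\<Sum>k\<in>{1..N}. p k * (c k + \<gamma> k * (d k - c k) * inverse (1 - p k))\<^sup>2) /
        (2 * (1 - l * C / 3)) - l * t)"
proof -
  obtain x0 where x0: "x0 \<in> set_pmf P" using set_pmf_not_empty by fast
  define \<mu> where "\<mu> = measure_pmf.expectation P f"
  define K where "K = \<bar>f x0\<bar> + (\<Sum>k\<in>{0<..N}. d k)"
  have K: "\<bar>f x\<bar> \<le> K" if "x \<in> set_pmf P" for x
    using Lipschitz_oscillation[OF Lip supp cd order_refl x0 that] by (simp add: K_def agree_def)
  have Kc: "\<bar>cexp P f j x\<bar> \<le> K" if "x \<in> set_pmf P" for j x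
    using that K by (rule cexp_abs_le)
  define h where "h = (\<lambda>k x. measure_pmf.prob (cond_prefix P k x) (- \<Gamma>))"
  define D where "D = (\<lambda>k x. if h (k - 1) x \<le> \<gamma> k then l * (cexp P f k x - cexp P f (k - 1) x) else 0)"
  define w where "w = (\<lambda>k. l\<^sup>2 * (p k * (c k + \<gamma> k * (d k - c k) * inverse (1 - p k))\<^sup>2) /
      (2 * (1 - l * C / 3)))"
  have den: "0 < 1 - l * C / 3" using l(3) by simp
  have mgf: "measure_pmf.expectation P (\<lambda>x. exp (\<Sum>j\<in>{1..N}. D j x)) \<le> exp (\<Sum>j\<in>{1..N}. w j)"
  proof (rule exp_moment_le[where K = "l * (K + K)" and N = N])
    fix j x y assume "y \<in> set_pmf P \<inter> agree j x"
    then show "D j y = D j x"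
      using cond_prefix_cong[where P = P and y = y and k = j and x = x and j = j] cond_prefix_cong[where P = P and y = y and k = j and x = x and j = "j - 1"]
      by (simp add: D_def h_def)
  next
    fix j x assume x: "x \<in> set_pmf P"
    have K0: "0 \<le> K" using K[OF x] by simp
    have "\<bar>cexp P f j x - cexp P f (j - 1) x\<bar> \<le> K + K"
      using Kc[OF x, of j] Kc[OF x, of "j - 1"] by linarith
    then have "\<bar>l * (cexp P f j x - cexp P f (j - 1) x)\<bar> \<le> l * (K + K)"
      unfolding abs_mult using l(1) by (simp only: abs_of_nonneg mult_left_mono)
    then show "\<bar>D j x\<bar> \<le> l * (K + K)" using K0 l(1) by (simp add: D_def)
  next
    fix j x assume j: "j \<in> {1..N}" and x: "x \<in> set_pmf P"
    let ?Q = "cond_prefix P (j - 1) x"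
    have Q: "set_pmf ?Q = set_pmf P \<inter> agree (j - 1) x" by (rule set_cond_prefix[OF x])
    have Qeq: "cond_prefix P (j - 1) y = ?Q" if "y \<in> set_pmf ?Q" for y
      using that unfolding Q by (auto intro: cond_prefix_cong)
    show "cexp P (\<lambda>y. exp (D j y)) (j - 1) x \<le> exp (w j)"
    proof (cases "h (j - 1) x \<le> \<gamma> j")
      \<comment> \<open>The truncation is decided by the first \<open>j - 1\<close> coordinates, so
        here \<open>D j\<close> vanishes on the whole support of \<open>?Q\<close> and contributes
        the factor one.\<close>
      case False
      then have "measure_pmf.expectation ?Q (\<lambda>y. exp (D j y)) = measure_pmf.expectation ?Q (\<lambda>y. 1)"
        using Qeq by (intro integral_cong_AE) (auto simp: AE_measure_pmf_iff D_def h_def)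
      also have "\<dots> = 1" by simp
      also have "1 \<le> exp (w j)"
        using p[OF j] den unfolding w_def one_le_exp_iff
        by (intro divide_nonneg_nonneg mult_nonneg_nonneg less_imp_le[OF den]) auto
      finally show ?thesis .
    next
      case True
      obtain \<eta> where \<eta>: "measure_pmf.prob ?Q {y. y j = \<eta>} \<ge> 1 - p j"
        using concentrated_cond_prefix[OF conc j x] .
      have tower_f: "measure_pmf.expectation ?Q (cexp P f j) = cexp P f (j - 1) x"
        by (rule cexp_tower[OF x _ K]) simp
      have tower_h: "measure_pmf.expectation ?Q (h j) = h (j - 1) x"
        using cexp_tower[OF x, of "j - 1" j "indicator (- \<Gamma>)" 1] by (simp add: h_def)
      \<comment> \<open>Under \<open>?Q\<close> the mean of \<open>h j\<close> is
        \<open>h (j - 1) x\<close>, hence at most \<open>\<gamma> j\<close>. Fixing coordinate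
        \<open>j\<close> to \<open>\<eta>\<close> determines the first \<open>j\<close> coordinates,
        so \<open>cexp P f j\<close> and \<open>h j\<close> are constant on that atom.\<close>
      have "cexp P (\<lambda>y. exp (D j y)) (j - 1) x =
          measure_pmf.expectation ?Q (\<lambda>y. exp (l * (cexp P f j y - measure_pmf.expectation ?Q (cexp P f j))))"
        unfolding tower_f using Qeq True
        by (intro integral_cong_AE) (auto simp: AE_measure_pmf_iff D_def h_def)
      also have "\<dots> \<le> exp (w j)"
        unfolding w_def
      proof (rule expectation_exp_centered_le[where h = "h j" and A = "{y. y j = \<eta>}"])
        show "0 \<le> h j y \<and> h j y \<le> 1" for y by (simp add: h_def)
        show "measure_pmf.expectation ?Q (h j) \<le> \<gamma> j" using True tower_h by simp
        show "\<bar>cexp P f j y - cexp P f j z\<bar> \<le> c j + (d j - c j) * h j y"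
          if "y \<in> set_pmf ?Q" "z \<in> set_pmf ?Q" for y z
          unfolding h_def using that Q
          by (intro Lipschitz_cexp_diff[OF Lip supp j _ _ _ K]) (auto simp: agree_def)
        show "cexp P f j y = cexp P f j z \<and> h j y = h j z"
          if "y \<in> set_pmf ?Q \<inter> {y. y j = \<eta>}" "z \<in> set_pmf ?Q \<inter> {y. y j = \<eta>}" for y z
        proof -
          have "{1..j} = insert j {1..j-1}" using j by auto
          then have "y \<in> agree j z" using that unfolding Q agree_def by auto
          then show ?thesis unfolding h_def using cond_prefix_cong[where P = P and y = y and k = j and x = z and j = j] by simp
        qed
      qed (use cd C l p \<eta> j in auto)
      finally show ?thesis .
    qed
  qed simp
  have iD: "integrable P (\<lambda>x. exp (\<Sum>j\<in>{1..N}. D j x))"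
  proof (rule integrable_measure_pmf_bounded)
    fix x assume x: "x \<in> set_pmf P"
    have "(\<Sum>j\<in>{1..N}. D j x) \<le> (\<Sum>j\<in>{1..N}. l * (K + K))"
    proof (rule sum_mono)
      fix j
      have "cexp P f j x - cexp P f (j - 1) x \<le> K + K"
        using Kc[OF x, of j] Kc[OF x, of "j - 1"] by linarith
      then show "D j x \<le> l * (K + K)"
        using l(1) K[OF x] by (simp add: D_def mult_left_mono)
    qed
    then show "\<bar>exp (\<Sum>j\<in>{1..N}. D j x)\<bar> \<le> exp (\<Sum>j\<in>{1..N}. l * (K + K))" by simp
  qed
  have sumD: "(\<Sum>j\<in>{1..N}. D j x) = l * (f x - \<mu>)"
    if x: "x \<in> set_pmf P" and good: "x \<notin> bad_event P N \<Lambda> \<Gamma> \<gamma>" for x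
  proof -
    have "D j x = l * (cexp P f j x - cexp P f (j - 1) x)" if "j \<in> {1..N}" for j
      using good x supp that by (auto simp: bad_event_def D_def h_def not_less)
    then have "(\<Sum>j\<in>{1..N}. D j x) = l * (\<Sum>j\<in>{1..N}. cexp P f j x - cexp P f (j - 1) x)"
      by (simp add: sum_distrib_left)
    also have "(\<Sum>j\<in>{1..N}. cexp P f j x - cexp P f (j - 1) x) = cexp P f N x - cexp P f 0 x"
      by (induction N) auto
    \<comment> \<open>All \<open>N\<close> coordinates are fixed, so \<open>x\<close> is the only
      outcome left in the support.\<close>
    also have "cexp P f N x = measure_pmf.expectation (cond_prefix P N x) (\<lambda>_. f x)"
    proof (intro integral_cong_AE)
      have "y = x" if "y \<in> set_pmf P \<inter> agree N x" for y
        by (rule PiE_ext[of _ "{1..N}" \<Lambda>]) (use that x supp in \<open>auto simp: agree_def\<close>)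
      then show "AE y in cond_prefix P N x. f y = f x"
        by (auto simp: AE_measure_pmf_iff set_cond_prefix[OF x])
    qed auto
    finally show ?thesis by (simp add: \<mu>_def)
  qed
  have "measure_pmf.prob P {x. f x \<ge> \<mu> + t \<and> x \<notin> bad_event P N \<Lambda> \<Gamma> \<gamma>} \<le>
      measure_pmf.prob P {x. exp (\<Sum>j\<in>{1..N}. D j x) \<ge> exp (l * t)}"
  proof (rule measure_pmf.finite_measure_mono_AE)
    have "exp (l * t) \<le> exp (\<Sum>j\<in>{1..N}. D j x)"
      if "x \<in> set_pmf P" "f x \<ge> \<mu> + t" "x \<notin> bad_event P N \<Lambda> \<Gamma> \<gamma>" for x
      unfolding exp_le_cancel_iff sumD[OF that(1,3)] using that(2) by (intro mult_left_mono l(1)) simp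
    then show "AE x in P. x \<in> {x. f x \<ge> \<mu> + t \<and> x \<notin> bad_event P N \<Lambda> \<Gamma> \<gamma>} \<longrightarrow>
        x \<in> {x. exp (\<Sum>j\<in>{1..N}. D j x) \<ge> exp (l * t)}"
      by (simp add: AE_measure_pmf_iff)
  qed simp
  also have "\<dots> \<le> measure_pmf.expectation P (\<lambda>x. exp (\<Sum>j\<in>{1..N}. D j x)) / exp (l * t)"
    using integral_Markov_inequality_measure[OF iD, of UNIV "exp (l * t)"] by simp
  also have "\<dots> \<le> exp (\<Sum>j\<in>{1..N}. w j) / exp (l * t)"
    using mgf by (intro divide_right_mono) auto
  also have "\<dots> = exp ((\<Sum>j\<in>{1..N}. w j) - l * t)" by (simp add: exp_diff)
  also have "(\<Sum>j\<in>{1..N}. w j) =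
      l\<^sup>2 * (\<Sum>k\<in>{1..N}. p k * (c k + \<gamma> k * (d k - c k) * inverse (1 - p k))\<^sup>2) / (2 * (1 - l * C / 3))"
    by (simp only: w_def sum_distrib_left sum_divide_distrib)
  finally show ?thesis by (simp add: \<mu>_def)
qed

theorem theorem17:
  fixes P :: "(nat \<Rightarrow> 'a) pmf"
    and N :: nat
    and \<Lambda> :: "nat \<Rightarrow> 'a set"
    and \<Gamma> :: "(nat \<Rightarrow> 'a) set"
    and \<gamma> :: "nat \<Rightarrow> real"
  assumes "N \<ge> 1"
    and "set_pmf P \<subseteq> PiE {1..N} \<Lambda>"
    and "\<Gamma> \<subseteq> PiE {1..N} \<Lambda>"
    and "\<And>k. k \<in> {1..N} \<Longrightarrow> 0 < \<gamma> k \<and> \<gamma> k \<le> 1"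
  shows "\<exists>B \<subseteq> PiE {1..N} \<Lambda>.
    \<P>(x in P. x \<in> B) \<le> (\<Sum>k\<in>{1..N}. inverse (\<gamma> k) * \<P>(x in P. x \<notin> \<Gamma>)) \<and>
    PiE {1..N} \<Lambda> - B \<subseteq> \<Gamma> \<and>
    (\<forall>(p :: nat \<Rightarrow> real) (f :: (nat \<Rightarrow> 'a) \<Rightarrow> real) (c :: nat \<Rightarrow> real) (d :: nat \<Rightarrow> real).
       (\<forall>k\<in>{1..N}. 0 \<le> p k \<and> p k < 1) \<and>
       concentrated P N \<Lambda> p \<and>
       (\<forall>k\<in>{1..N}. c k \<le> d k) \<and>
       general_Lipschitz P N \<Lambda> \<Gamma> f c d \<longrightarrow>
       (let \<mu> = measure_pmf.expectation P f;
            e = (\<lambda>k. \<gamma> k * (d k - c k));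
            C = Max ((\<lambda>k. c k + e k) ` {1..N})
        in \<forall>t\<ge>0.
          \<P>(x in P. f x \<ge> \<mu> + t \<and> x \<notin> B) \<le>
            exp (- (t\<^sup>2 / (2 * (\<Sum>k\<in>{1..N}. p k * (c k + e k * inverse (1 - p k))\<^sup>2)
                          + 2 * C * t / 3)))))"
\<comment> \<open>The witness is built from the law, \<open>\<Gamma>\<close> and
  \<open>\<gamma>\<close> alone, before \<open>f\<close> and \<open>t\<close> are
  introduced.\<close>
proof (intro exI[of _ "bad_event P N \<Lambda> \<Gamma> \<gamma>"] conjI allI impI)
  show "bad_event P N \<Lambda> \<Gamma> \<gamma> \<subseteq> PiE {1..N} \<Lambda>" "PiE {1..N} \<Lambda> - bad_event P N \<Lambda> \<Gamma> \<gamma> \<subseteq> \<Gamma>"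
    by (auto simp: bad_event_def)
  have "{x. x \<notin> \<Gamma>} = - \<Gamma>" by auto
  then show "\<P>(x in P. x \<in> bad_event P N \<Lambda> \<Gamma> \<gamma>) \<le> (\<Sum>k\<in>{1..N}. inverse (\<gamma> k) * \<P>(x in P. x \<notin> \<Gamma>))"
    using prob_bad_event_le[of N \<gamma> P \<Lambda> \<Gamma>] assms(1,4) by simp
next
  fix p f c d
  assume "(\<forall>k\<in>{1..N}. 0 \<le> p k \<and> p k < 1) \<and> concentrated P N \<Lambda> p \<and>
    (\<forall>k\<in>{1..N}. c k \<le> d k) \<and> general_Lipschitz P N \<Lambda> \<Gamma> f c d"
  then have p: "\<And>k. k \<in> {1..N} \<Longrightarrow> 0 \<le> p k \<and> p k < 1" and conc: "concentrated P N \<Lambda> p"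
    and cd: "\<And>k. k \<in> {1..N} \<Longrightarrow> c k \<le> d k" and Lip: "general_Lipschitz P N \<Lambda> \<Gamma> f c d"
    by auto
  let ?B = "bad_event P N \<Lambda> \<Gamma> \<gamma>"
  define \<mu> where "\<mu> = measure_pmf.expectation P f"
  define C where "C = Max ((\<lambda>k. c k + \<gamma> k * (d k - c k)) ` {1..N})"
  define V where "V = (\<Sum>k\<in>{1..N}. p k * (c k + \<gamma> k * (d k - c k) * inverse (1 - p k))\<^sup>2)"
  have V: "0 \<le> V" unfolding V_def using p by (intro sum_nonneg) auto
  have C: "c k + \<gamma> k * (d k - c k) \<le> C" if "k \<in> {1..N}" for k
    unfolding C_def using that by (intro Max_ge) auto
  have bound: "measure_pmf.prob P {x. f x \<ge> \<mu> + t \<and> x \<notin> ?B} \<le>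
      exp (- (t\<^sup>2 / (2 * V + 2 * C * t / 3)))" if t: "0 \<le> t" for t
  \<comment> \<open>If the bad event covers the support, the left side is zero. Otherwise the
    support meets \<open>\<Gamma>\<close>, which is what gives the numbers \<open>c k\<close>, and
    then \<open>C\<close>, their sign.\<close>
  proof (cases "set_pmf P \<subseteq> ?B")
    case True
    then have "measure_pmf.prob P {x. f x \<ge> \<mu> + t \<and> x \<notin> ?B} = 0"
      by (auto simp: measure_pmf_zero_iff)
    then show ?thesis by simp
  next
    case False
    then obtain y where y: "y \<in> set_pmf P" "y \<in> \<Gamma>"
      using assms(2) by (auto simp: bad_event_def)
    have c0: "0 \<le> c k" if k: "k \<in> {1..N}" for k
    proof -
      \<comment> \<open>The Lipschitz condition is applied with both outcomes of coordinate
        \<open>k\<close> equal to \<open>y k\<close>; at \<open>y\<close> it bounds an absolute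
        value by \<open>c k\<close>.\<close>
      obtain \<rho> where "\<And>x. x \<in> set_pmf P \<inter> agree k y \<Longrightarrow> \<bar>f x - f (\<rho> x)\<bar> \<le> (if x \<in> \<Gamma> then c k else d k)"
        using Lipschitz_injection[OF Lip assms(2) k y(1,1) agree_refl] by metis
      from this[of y] y show ?thesis by simp
    qed
    have e0: "0 \<le> \<gamma> k * (d k - c k)" if "k \<in> {1..N}" for k
      using cd[OF that] assms(4)[OF that] by simp
    have C0: "0 \<le> C" using C[of 1] c0[of 1] e0[of 1] assms(1) by simp
    show ?thesis
    proof (cases "t = 0 \<or> C = 0")
      case True
      \<comment> \<open>If \<open>C = 0\<close>, all \<open>c k\<close> and \<open>e k\<close>
        vanish and the denominator is zero. Division by zero yields zero, so the claimed bound is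
        \<open>exp 0 = 1\<close>, as it is for \<open>t = 0\<close>.\<close>
      have "V = 0" if "C = 0"
        unfolding V_def
      proof (intro sum.neutral ballI)
        fix k assume k: "k \<in> {1..N}"
        then have "c k = 0" "\<gamma> k * (d k - c k) = 0"
          using C[OF k] c0[OF k] e0[OF k] that by linarith+
        then show "p k * (c k + \<gamma> k * (d k - c k) * inverse (1 - p k))\<^sup>2 = 0" by simp
      qed
      then have zero: "t\<^sup>2 / (2 * V + 2 * C * t / 3) = 0" using True by auto
      show ?thesis unfolding zero by simp
    next
      case False
      then have "0 < t" "0 < C" using t C0 by auto
      then obtain l where l: "0 \<le> l" "l * C < 3"
        "l\<^sup>2 * V / (2 * (1 - l * C / 3)) - l * t \<le> - (t\<^sup>2 / (2 * V + 2 * C * t / 3))"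
        using bernstein_exponent[OF V] by metis
      have "measure_pmf.prob P {x. f x \<ge> \<mu> + t \<and> x \<notin> ?B} \<le>
          exp (l\<^sup>2 * V / (2 * (1 - l * C / 3)) - l * t)"
        unfolding \<mu>_def V_def
        using l C0 by (intro tail_bound[OF assms(2) _ p conc cd Lip C]) (auto simp: assms(4))
      also have "\<dots> \<le> exp (- (t\<^sup>2 / (2 * V + 2 * C * t / 3)))" using l(3) by simp
      finally show ?thesis .
    qed
  qed
  then show "let \<mu> = measure_pmf.expectation P f; e = (\<lambda>k. \<gamma> k * (d k - c k));
      C = Max ((\<lambda>k. c k + e k) ` {1..N})
    in \<forall>t\<ge>0. \<P>(x in P. f x \<ge> \<mu> + t \<and> x \<notin> ?B) \<le>
        exp (- (t\<^sup>2 / (2 * (\<Sum>k\<in>{1..N}. p k * (c k + e k * inverse (1 - p k))\<^sup>2) + 2 * C * t / 3)))"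
    unfolding Let_def \<mu>_def C_def V_def by simp
qed

end
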